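(* Let $c_1>0$ be a constant, let $N$ be an infinite set of positive integers, and for each $n\in N$ let $P_n\subset\mathbb{R}^2$ be a set of $n$ points that determines at least $c_1 n^{4/3}$ unordered pairs of points at distance exactly $1$. Let $G(P_n)$ be the unit-circle graph drawing associated to $P_n$. Then: (1) for every function $f:N\to[0,\infty)$ with $f(n)=o(n^{2/3})$, the number of edges of $G(P_n)$ having at most $f(n)$ crossings is $o(n^{4/3})$ as $n\to\infty$ in $N$; (2) for every function $g:N\to[0,\infty)$ with $g(n)=\omega(n^{2/3})$ (i.e. $g(n)/n^{2/3}\to\infty$), the number of edges of $G(P_n)$ having at least $g(n)$ crossings is $o(n^{4/3})$ as $n\to\infty$ in $N$.
   Context: For a finite set $P\subset\mathbb{R}^2$, the associated unit-circle graph drawing $G(P)$ is the following (multi)graph drawn in the plane. Its vertices are the points of $P$. For each $p\in P$ draw the circle $C(p)$ of radius $1$ centered at $p$; the points of $P$ on $C(p)$ cut $C(p)$ into arcs, and each arc joining two consecutive points of $P$ on $C(p)$ is an edge (so a circle containing $k\ge 1$ points of $P$ contributes $k$ edges, and the total number of edges is twice the number of unit distances determined by $P$). The number of crossings of an edge $e$ is the number of crossings on $e$ in this drawing, i.e. the number of pairs $(e',x)$ where $e'\neq e$ is another edge and $x$ is a point lying in the relative interior of both $e$ and $e'$. *)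

theory Defs
  imports "HOL-Analysis.Analysis" "HOL-Library.Landau_Symbols"
begin

definition unit_distances :: "(real^2) set \<Rightarrow> (real^2) set set" where
  "unit_distances P = {{p, q} | p q. p \<in> P \<and> q \<in> P \<and> dist p q = 1}"

text \<open>
  An edge of the drawing is represented by the pair of the centre of its circle and its
  relative interior, i.e. the open arc without its end points in \<open>P\<close>. The open arcs into which
  \<open>P\<close> cuts a circle are the connected components of the circle minus \<open>P\<close>. Open arcs are used
  because for a circle containing exactly one point of \<open>P\<close> the edge is a loop, whose closed
  arc is the whole circle and does not determine the relative interior. A circle containing
  no point of \<open>P\<close> contributes no edge, although it is a component of itself.
\<close>

definition edges :: "(real^2) set \<Rightarrow> ((real^2) \<times> (real^2) set) set" where
  "edges P = {(p, A). p \<in> P \<and> sphere p 1 \<inter> P \<noteq> {} \<and> A \<in> components (sphere p 1 - P)}"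

definition crossings ::
  "(real^2) set \<Rightarrow> (real^2) \<times> (real^2) set \<Rightarrow> (((real^2) \<times> (real^2) set) \<times> (real^2)) set" where
  "crossings P e = {(e', x). e' \<in> edges P \<and> e' \<noteq> e \<and> x \<in> snd e \<and> x \<in> snd e'}"

text \<open>The filter for limits as \<open>n \<rightarrow> \<infinity>\<close> with \<open>n \<in> N\<close>.\<close>

definition at_top_in :: "nat set \<Rightarrow> nat filter" where
  "at_top_in N = inf at_top (principal N)"

end

theory Submission
  imports Defs
begin

text \<open>
  Two distinct unit circles meet in at most two points, so the drawing has at most \<open>2 n\<^sup>2\<close>
  crossings in total, which gives (2).

  For (1), at most \<open>2 n\<close> edges contain the leftmost or rightmost point of their circle. Every other
  edge is an \<open>x\<close>-monotone arc of an upper or a lower semicircle, and two upper semicircles with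
  distinct centres meet at most once. Hence no two of the upper arcs join the same two points, and
  arcs that cross have no common end point. So the crossing lemma applies to the \<open>m\<close> upper (or lower)
  arcs with at most \<open>t\<close> crossings: they have at least a constant times \<open>m\<^sup>3 / n\<^sup>2\<close> crossings among
  each other once \<open>m\<close> exceeds a multiple of \<open>n\<close>, but at most \<open>m t\<close>, so \<open>m = O(n + n \<surd>t)\<close>. The linear
  bound on noncrossing arcs that the crossing lemma needs comes from a sweep line argument, in place
  of Euler's formula.
\<close>

subsection \<open>Noncrossing monotone arcs\<close>


text \<open>An arc is encoded as the graph of \<open>f e\<close> over the interval from
  \<open>l e\<close> to \<open>r e\<close>, so that above and below make sense. Arcs may cross here.
  \<open>simple\<close> excludes parallel arcs, without which no bound in terms of
  \<open>card S\<close> could hold.\<close>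

locale monotone_arcs =
  fixes S :: "(real \<times> real) set" and E :: "'e set"
    and l r :: "'e \<Rightarrow> real" and f :: "'e \<Rightarrow> real \<Rightarrow> real"
  assumes finite_S: "finite S" and finite_E: "finite E"
    and l_less_r: "e \<in> E \<Longrightarrow> l e < r e"
    and cont: "e \<in> E \<Longrightarrow> continuous_on {l e..r e} (f e)"
    and left_in: "e \<in> E \<Longrightarrow> (l e, f e (l e)) \<in> S"
    and right_in: "e \<in> E \<Longrightarrow> (r e, f e (r e)) \<in> S"
    and avoid: "\<lbrakk>e \<in> E; l e < x; x < r e\<rbrakk> \<Longrightarrow> (x, f e x) \<notin> S"
    and simple: "\<lbrakk>e \<in> E; e' \<in> E; l e = l e'; f e (l e) = f e' (l e'); r e = r e'; f e (r e) = f e' (r e')\<rbrakk>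
      \<Longrightarrow> e = e'"

locale noncrossing_arcs = monotone_arcs +
  assumes noncrossing: "\<lbrakk>e \<in> E; e' \<in> E; e \<noteq> e'; l e < x; l e' < x; x < r e; x < r e'\<rbrakk> \<Longrightarrow> f e x \<noteq> f e' x"
begin

text \<open>The relation is vacuously true in both directions for arcs whose open intervals are
  disjoint. Hence the overlap hypotheses in the lemmas that exclude or compare.\<close>

definition below :: "'a \<Rightarrow> 'a \<Rightarrow> bool" where
  "below e e' \<longleftrightarrow> (\<forall>x. l e < x \<longrightarrow> l e' < x \<longrightarrow> x < r e \<longrightarrow> x < r e' \<longrightarrow> f e x < f e' x)"

text \<open>Intermediate value theorem: over the common open interval the difference of the two arcs
  is continuous, and a change of sign would give a crossing.\<close>

lemma below_if_less:
  assumes "e \<in> E" "e' \<in> E" "l e < x" "l e' < x" "x < r e" "x < r e'" "f e x < f e' x"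
  shows "below e e'"
  unfolding below_def
proof (intro allI impI)
  fix y assume y: "l e < y" "l e' < y" "y < r e" "y < r e'"
  show "f e y < f e' y"
  proof (rule ccontr)
    assume c: "\<not> f e y < f e' y"
    let ?I = "{max (l e) (l e')<..<min (r e) (r e')}"
    let ?g = "\<lambda>x. f e' x - f e x"
    have "continuous_on ?I ?g"
      by (intro continuous_intros continuous_on_subset[OF cont[OF assms(1)]]
          continuous_on_subset[OF cont[OF assms(2)]]) auto
    then have "connected (?g ` ?I)"
      by (intro connected_continuous_image) auto
    moreover have "?g x \<in> ?g ` ?I" "?g y \<in> ?g ` ?I"
      using assms y by auto
    moreover have "?g y \<le> 0" "0 \<le> ?g x" using c assms by auto
    ultimately have "0 \<in> ?g ` ?I"
      by (meson connectedD_interval)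
    then obtain z where "z \<in> ?I" "f e z = f e' z" by auto
    moreover have "e \<noteq> e'" using assms by auto
    ultimately show False using noncrossing[of e e' z] assms by auto
  qed
qed

text \<open>The strict inequality passes to the closed common interval by continuity, but only
  weakly, since the arcs may share an end point.\<close>

lemma below_le:
  assumes "e \<in> E" "e' \<in> E" "below e e'" "max (l e) (l e') < min (r e) (r e')"
    and x: "l e \<le> x" "l e' \<le> x" "x \<le> r e" "x \<le> r e'"
  shows "f e x \<le> f e' x"
proof -
  let ?I = "{max (l e) (l e')<..<min (r e) (r e')}"
  have cl: "closure ?I = {max (l e) (l e')..min (r e) (r e')}"
    using assms(4) by simp
  have "0 \<le> f e' x - f e x"
  proof (rule continuous_ge_on_closure[where f = "\<lambda>x. f e' x - f e x" and S = ?I])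
    show "continuous_on (closure ?I) (\<lambda>x. f e' x - f e x)"
      unfolding cl
      by (intro continuous_intros continuous_on_subset[OF cont[OF assms(1)]]
          continuous_on_subset[OF cont[OF assms(2)]]) auto
    show "x \<in> closure ?I" unfolding cl using x by auto
    show "0 \<le> f e' y - f e y" if "y \<in> ?I" for y
      using assms(3) that unfolding below_def by (auto simp: less_imp_le)
  qed
  then show ?thesis by simp
qed

lemma below_cases:
  assumes "e \<in> E" "e' \<in> E" "e \<noteq> e'" "max (l e) (l e') < min (r e) (r e')"
  shows "below e e' \<or> below e' e"
proof -
  obtain x where x: "max (l e) (l e') < x" "x < min (r e) (r e')"
    using assms(4) dense by blast
  then have "f e x \<noteq> f e' x"
    using noncrossing[of e e' x] assms by auto
  then show ?thesis
    using below_if_less[of e e' x] below_if_less[of e' e x] x assms by force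
qed

lemma not_below_both:
  assumes "max (l e) (l e') < min (r e) (r e')" "below e e'" "below e' e"
  shows False
proof -
  obtain x where "max (l e) (l e') < x" "x < min (r e) (r e')"
    using assms(1) dense by blast
  then show False using assms(2,3) unfolding below_def by force
qed

text \<open>Unlike in \<open>below_if_less\<close>, \<open>x\<close> may be a right end here. The
  arcs overlap to the left of \<open>x\<close>, so they are comparable, and the opposite order would
  contradict \<open>below_le\<close> at \<open>x\<close>.\<close>

lemma below_if_less_right:
  assumes "e \<in> E" "e' \<in> E" "l e < x" "l e' < x" "x \<le> r e" "x \<le> r e'" "f e x < f e' x"
  shows "below e e'"
  using below_cases[of e e'] below_le[of e' e x] assms by force

section \<open>Consecutive arcs from a common left end and their events\<close>

definition coinitial :: "'a \<Rightarrow> 'a \<Rightarrow> bool" where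
  "coinitial e e' \<longleftrightarrow> l e = l e' \<and> f e (l e) = f e' (l e')"

text \<open>Only arcs from the same left end are kept out of the region between the two; arcs that
  start elsewhere may lie in it.\<close>

definition consecutive :: "'a \<Rightarrow> 'a \<Rightarrow> bool" where
  "consecutive e e' \<longleftrightarrow> e \<in> E \<and> e' \<in> E \<and> coinitial e e' \<and> below e e' \<and>
     \<not> (\<exists>g\<in>E. coinitial e g \<and> below e g \<and> below g e')"

text \<open>Just to the right of their common left end, all coinitial arcs are ordered by height, so
  there is a lowest one among those above \<open>e\<close>.\<close>

lemma ex_consecutive:
  assumes "e \<in> E" "e' \<in> E" "coinitial e e'" "below e e'"
  shows "\<exists>e'. consecutive e e'"
proof -
  define F where "F = {g \<in> E. coinitial e g}"
  have F: "finite F" "F \<noteq> {}" "e \<in> F"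
    using finite_E assms by (auto simp: F_def coinitial_def)
  \<comment> \<open>Left of the first right end, the vertical line at \<open>x\<close> meets every
    arc of \<open>F\<close> in its interior, so \<open>below\<close> on \<open>F\<close> is the
    order of the values at \<open>x\<close>.\<close>
  obtain x where x: "l e < x" "x < Min (r ` F)"
  proof -
    have "l e < Min (r ` F)"
      using F by (auto simp: F_def coinitial_def l_less_r)
    then show ?thesis using dense that by blast
  qed
  then have xF: "l g < x" "x < r g" "g \<in> E" if "g \<in> F" for g
    using F that by (auto simp: F_def coinitial_def)
  have iff: "below g h \<longleftrightarrow> f g x < f h x" if "g \<in> F" "h \<in> F" for g h
    using below_if_less[of g h x] xF[OF that(1)] xF[OF that(2)] unfolding below_def by blast
  define G where "G = {g \<in> F. below e g}"
  have "e' \<in> G" using assms by (simp add: G_def F_def)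
  then have G: "finite G" "G \<noteq> {}"
    using F(1) by (auto simp: G_def)
  obtain g where g: "g \<in> G" "\<And>h. h \<in> G \<Longrightarrow> f g x \<le> f h x"
    using ex_is_arg_min_if_finite[OF G, of "\<lambda>g. f g x"] by (auto simp: is_arg_min_linorder)
  have "consecutive e g"
    unfolding consecutive_def
  proof (intro conjI notI)
    assume "\<exists>h\<in>E. coinitial e h \<and> below e h \<and> below h g"
    then obtain h where h: "h \<in> G" "below h g" by (auto simp: G_def F_def)
    then have "f h x < f g x" using iff[of h g] g by (auto simp: G_def)
    then show False using g(2)[OF h(1)] by simp
  qed (use g in \<open>auto simp: G_def F_def assms\<close>)
  then show ?thesis ..
qed

text \<open>The vertex at which a sweep line moving to the right first leaves the region between two
  consecutive arcs.\<close>

definition is_event :: "'a \<Rightarrow> 'a \<Rightarrow> real \<times> real \<Rightarrow> bool" where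
  "is_event e e' w \<longleftrightarrow>
     is_arg_min fst (\<lambda>(x, y). (x, y) \<in> S \<and> l e < x \<and> x \<le> r e \<and> x \<le> r e' \<and> f e x \<le> y \<and> y \<le> f e' x) w"

lemma consecutive_overlap:
  "consecutive e e' \<Longrightarrow> max (l e) (l e') < min (r e) (r e')"
  by (auto simp: consecutive_def coinitial_def l_less_r dest: l_less_r)

text \<open>The right end of whichever arc stops first is a candidate, and \<open>S\<close> is
  finite.\<close>

lemma ex_event:
  assumes "consecutive e e'"
  shows "\<exists>w. is_event e e' w"
proof -
  define W where
    "W = {(x, y). (x, y) \<in> S \<and> l e < x \<and> x \<le> r e \<and> x \<le> r e' \<and> f e x \<le> y \<and> y \<le> f e' x}"
  note ov = consecutive_overlap[OF assms]
  have e: "e \<in> E" "e' \<in> E" "below e e'" "l e = l e'"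
    using assms by (auto simp: consecutive_def coinitial_def)
  let ?x = "min (r e) (r e')"
  have le: "f e ?x \<le> f e' ?x"
    by (rule below_le[OF e(1-3) ov]) (use ov in auto)
  have "W \<noteq> {}"
  proof (cases "r e \<le> r e'")
    case True
    then have "(r e, f e (r e)) \<in> W"
      using le ov e right_in[of e] by (auto simp: W_def min_def)
    then show ?thesis by blast
  next
    case False
    then have "(r e', f e' (r e')) \<in> W"
      using le ov e right_in[of e'] by (auto simp: W_def min_def)
    then show ?thesis by blast
  qed
  moreover have "finite W"
    by (rule finite_subset[OF _ finite_S]) (auto simp: W_def)
  ultimately obtain w where "is_arg_min fst (\<lambda>w. w \<in> W) w"
    using ex_is_arg_min_if_finite by blast
  then show ?thesis
    by (intro exI[of _ w]) (simp add: is_event_def W_def)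
qed

lemma is_eventD:
  assumes "is_event e e' (x, y)"
  shows "(x, y) \<in> S" "l e < x" "x \<le> r e" "x \<le> r e'" "f e x \<le> y" "y \<le> f e' x"
  using assms by (auto simp: is_event_def is_arg_min_def)

lemma is_event_le:
  assumes "is_event e e' (x, y)"
    and "(x', y') \<in> S" "l e < x'" "x' \<le> r e" "x' \<le> r e'" "f e x' \<le> y'" "y' \<le> f e' x'"
  shows "x \<le> x'"
  using assms by (force simp: is_event_def is_arg_min_def not_less)

text \<open>Followed to the left, an arc between the two would end at a vertex before the event or be
  squeezed into the common left end point.\<close>

lemma no_arc_between:
  assumes c: "consecutive e e'" and w: "is_event e e' (x, y)"
    and g: "g \<in> E" "l g < x" "x \<le> r g" "below e g" "below g e'"
  shows False
proof -
  note le = is_event_le[OF w] and w = is_eventD[OF w]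
  have e: "e \<in> E" "e' \<in> E" "below e e'" and a: "l e = l e'" "f e (l e) = f e' (l e')"
    using c by (auto simp: consecutive_def coinitial_def)
  define z where "z = max (l g) (l e)"
  have "f e z \<le> f g z" "f g z \<le> f e' z"
    using below_le[OF e(1) g(1) g(4), of z] below_le[OF g(1) e(2) g(5), of z] w g a
    by (auto simp: z_def)
  show False
  proof (cases "l g \<le> l e")
    case True
    then have eq: "f g (l e) = f e (l e)"
      using \<open>f e z \<le> f g z\<close> \<open>f g z \<le> f e' z\<close> a by (auto simp: z_def)
    \<comment> \<open>The squeezed arc either starts at the common left end, against
      \<open>consecutive\<close>, or has that vertex in its interior, against
      \<open>avoid\<close>.\<close>
    show False
    proof (cases "l g = l e")
      case True
      then have "coinitial e g" using eq by (simp add: coinitial_def)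
      then show False using c g by (auto simp: consecutive_def)
    next
      case False
      then show False
        using avoid[OF g(1), of "l e"] left_in[OF e(1)] eq w g \<open>l g \<le> l e\<close> by auto
    qed
  next
    case False
    then show False
      using le[of "l g" "f g (l g)"] left_in[OF g(1)] w g \<open>f e z \<le> f g z\<close> \<open>f g z \<le> f e' z\<close>
      by (auto simp: z_def)
  qed
qed

text \<open>Let \<open>e1\<close> be the lower of the two lower arcs. At \<open>x\<close> the arc
  \<open>e2\<close> is not above the event, which is strictly below \<open>e1'\<close>. So
  \<open>e2\<close> lies between \<open>e1\<close> and \<open>e1'\<close>, which
  \<open>no_arc_between\<close> forbids.\<close>

lemma event_upper_unique:
  assumes c: "consecutive e1 e1'" "consecutive e2 e2'"
    and w: "is_event e1 e1' (x, y)" "is_event e2 e2' (x, y)"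
    and y: "y < f e1' x" "y < f e2' x"
  shows "e1 = e2"
proof (rule ccontr)
  assume ne: "e1 \<noteq> e2"
  have *: False
    if c: "consecutive e1 e1'" "consecutive e2 e2'"
      and w: "is_event e1 e1' (x, y)" "is_event e2 e2' (x, y)"
      and y: "y < f e1' x" and b: "below e1 e2" for e1 e1' e2 e2'
  proof -
    note w1 = is_eventD[OF w(1)] and w2 = is_eventD[OF w(2)]
    have e: "e1 \<in> E" "e1' \<in> E" "e2 \<in> E" "l e1 = l e1'"
      using c by (auto simp: consecutive_def coinitial_def)
    have "below e2 e1'"
      by (rule below_if_less_right[where x = x]) (use e w1 w2 y in auto)
    then show False
      using no_arc_between[OF c(1) w(1) e(3)] w2 b by auto
  qed
  have "e1 \<in> E" "e2 \<in> E" using c by (auto simp: consecutive_def)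
  then have "below e1 e2 \<or> below e2 e1"
    using below_cases[OF _ _ ne] is_eventD[OF w(1)] is_eventD[OF w(2)] by auto
  then show False using *[OF c w] *[OF c(2,1) w(2,1)] y by blast
qed

text \<open>By \<open>avoid\<close> an arc can meet a vertex only at an end. If the lower arc met
  the event too, both arcs would end there and be parallel, against \<open>simple\<close>.\<close>

lemma event_on_upper_arc:
  assumes c: "consecutive e e'" and w: "is_event e e' (x, y)" and y: "y = f e' x"
  shows "x = r e'" "f e x < f e' x"
proof -
  note w = is_eventD[OF w]
  have e: "e \<in> E" "e' \<in> E" "coinitial e e'" "below e e'" and ll: "l e = l e'"
    using c by (auto simp: consecutive_def coinitial_def)
  show x: "x = r e'"
    using avoid[OF e(2), of x] w y ll by fastforce
  show "f e x < f e' x"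
  proof (rule ccontr)
    assume "\<not> f e x < f e' x"
    then have "y = f e x" using w y by simp
    moreover have "x = r e"
      using avoid[OF e(1), of x] w \<open>y = f e x\<close> by fastforce
    ultimately have "e = e'"
      using simple[OF e(1,2)] e(3) x y unfolding coinitial_def by metis
    then show False
      using not_below_both[OF consecutive_overlap[OF c]] e by simp
  qed
qed

text \<open>Both upper arcs end at the event. Were they distinct, the lower of them would lie inside
  the region of the other pair, against \<open>no_arc_between\<close>.\<close>

lemma event_lower_unique:
  assumes c: "consecutive e1 e1'" "consecutive e2 e2'"
    and w: "is_event e1 e1' (x, y)" "is_event e2 e2' (x, y)"
    and y: "y = f e1' x" "y = f e2' x"
  shows "e1 = e2"
proof (rule ccontr)
  assume ne: "e1 \<noteq> e2"
  have *: False
    if c: "consecutive e1 e1'" "consecutive e2 e2'"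
      and w: "is_event e1 e1' (x, y)" "is_event e2 e2' (x, y)"
      and y: "y = f e1' x" "y = f e2' x" and b: "below e2' e1'" for e1 e1' e2 e2'
  proof -
    note w1 = is_eventD[OF w(1)] and w2 = is_eventD[OF w(2)]
    have e: "e1 \<in> E" "e1' \<in> E" "e2' \<in> E" "l e1 = l e1'" "l e2 = l e2'"
      using c by (auto simp: consecutive_def coinitial_def)
    have "below e1 e2'"
      by (rule below_if_less_right[where x = x])
        (use e w1 w2 y event_on_upper_arc[OF c(1) w(1)] in auto)
    then show False
      using no_arc_between[OF c(1) w(1) e(3)] w2 b e by auto
  qed
  have e: "e1 \<in> E" "e2 \<in> E" "e1' \<in> E" "e2' \<in> E" "l e1 = l e1'" "l e2 = l e2'"
    using c by (auto simp: consecutive_def coinitial_def)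
  note ww = is_eventD[OF w(1)] is_eventD[OF w(2)]
  have "e1' = e2'"
  proof (rule ccontr)
    assume "e1' \<noteq> e2'"
    moreover have "max (l e1') (l e2') < min (r e1') (r e2')"
      using e(5,6) ww by simp
    ultimately have "below e1' e2' \<or> below e2' e1'"
      using below_cases[of e1' e2'] e by blast
    then show False using *[OF c w] *[OF c(2,1) w(2,1)] y by blast
  qed
  \<comment> \<open>With a common upper arc, \<open>e1\<close> and \<open>e2\<close> share their
    left end, so the higher of them would separate the lower from that upper arc.\<close>
  have "below e1 e2 \<or> below e2 e1"
    using below_cases[OF e(1,2) ne] ww by auto
  then show False
    using c \<open>e1' = e2'\<close> unfolding consecutive_def coinitial_def by metis
qed

text \<open>Each left end has at most one topmost arc, collected in \<open>T\<close>. Every other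
  arc is charged to the event of the region between it and the next arc. A vertex receives at most
  two charges: one from a region whose upper arc passes strictly above it, and one from a region
  whose upper arc ends there. The Boolean in \<open>?h\<close> tells the two apart.\<close>

theorem card_arcs_le: "card E \<le> 3 * card S"
proof -
  define T where "T = {e \<in> E. \<not> (\<exists>e'\<in>E. coinitial e e' \<and> below e e')}"
  have "inj_on (\<lambda>e. (l e, f e (l e))) T"
  proof (rule inj_onI, rule ccontr)
    fix e g assume *: "e \<in> T" "g \<in> T" "(l e, f e (l e)) = (l g, f g (l g))" "e \<noteq> g"
    then have "below e g \<or> below g e"
      by (intro below_cases) (auto simp: T_def l_less_r dest: l_less_r)
    then show False using * by (auto simp: T_def coinitial_def)
  qed
  then have T: "card T \<le> card S"
    by (rule card_inj_on_le[OF _ _ finite_S]) (auto simp: T_def left_in)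
  have "\<forall>e\<in>E - T. \<exists>e' w. consecutive e e' \<and> is_event e e' w"
    using ex_consecutive ex_event unfolding T_def by blast
  then obtain s w where sw: "\<And>e. e \<in> E - T \<Longrightarrow> consecutive e (s e) \<and> is_event e (s e) (w e)"
    by metis
  let ?h = "\<lambda>e. (w e, snd (w e) < f (s e) (fst (w e)))"
  have "inj_on ?h (E - T)"
  proof (rule inj_onI)
    fix e g assume e: "e \<in> E - T" and g: "g \<in> E - T" and eq: "?h e = ?h g"
    obtain x y where xy: "w e = (x, y)" by (cases "w e")
    note ce = sw[OF e] and cg = sw[OF g]
    have ev: "is_event e (s e) (x, y)" "is_event g (s g) (x, y)"
      using ce cg eq xy by auto
    have wg: "w g = (x, y)" using eq xy by simp
    show "e = g"
    proof (cases "y < f (s e) x")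
      case True
      then have "y < f (s g) x" using eq unfolding xy wg by simp
      then show ?thesis using event_upper_unique[OF _ _ ev True] ce cg by blast
    next
      case False
      then have "y = f (s e) x" "y = f (s g) x"
        using is_eventD(6)[OF ev(1)] is_eventD(6)[OF ev(2)] eq unfolding xy wg by simp_all
      then show ?thesis using event_lower_unique[OF _ _ ev] ce cg by blast
    qed
  qed
  moreover have "?h ` (E - T) \<subseteq> S \<times> UNIV"
    using sw is_eventD(1) by (auto) (metis Diff_iff prod.collapse)
  ultimately have "card (E - T) \<le> card (S \<times> (UNIV :: bool set))"
    by (rule card_inj_on_le) (simp add: finite_S)
  also have "\<dots> = 2 * card S" by (simp add: card_cartesian_product)
  finally show ?thesis
    using T card_Un_disjoint[of T "E - T"] finite_E
    by (simp add: T_def card_Diff_subset)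
qed

end


subsection \<open>A crossing lemma for monotone arcs\<close>

text \<open>A random vertex set of density \<open>1 / k\<close> is modelled as colour class 0 of a
  uniform colouring with \<open>k\<close> colours. All of \<open>T\<close> lies in it with
  probability \<open>1 / k ^ card T\<close>; multiplying out keeps the count in the
  naturals.\<close>

lemma card_colourings_zero:
  assumes "finite S" "T \<subseteq> S" "k \<ge> 1"
  shows "card {c \<in> S \<rightarrow>\<^sub>E {..<k::nat}. \<forall>v\<in>T. c v = 0} * k ^ card T = k ^ card S"
proof -
  let ?B = "\<lambda>v. if v \<in> T then {0} else {..<k}"
  have "{c \<in> S \<rightarrow>\<^sub>E {..<k}. \<forall>v\<in>T. c v = 0} = Pi\<^sub>E S ?B"
  proof (intro set_eqI iffI)
    fix c assume "c \<in> Pi\<^sub>E S ?B"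
    moreover from this have "c v = 0" if "v \<in> T" for v
      using that assms(2) PiE_mem[of c S ?B v] by auto
    moreover have "?B v \<subseteq> {..<k}" for v using assms(3) by auto
    ultimately show "c \<in> {c \<in> S \<rightarrow>\<^sub>E {..<k}. \<forall>v\<in>T. c v = 0}"
      using PiE_mono[of S ?B "\<lambda>_. {..<k}"] by blast
  qed (auto simp: PiE_iff)
  also have "card \<dots> = (\<Prod>v\<in>S. card (?B v))"
    by (simp add: card_PiE assms)
  also have "\<dots> = (\<Prod>v\<in>S - T. k)"
    using assms by (intro prod.mono_neutral_cong_right) auto
  also have "\<dots> = k ^ (card S - card T)"
    using assms by (simp add: card_Diff_subset finite_subset)
  finally show ?thesis
    using assms by (simp flip: power_add add: card_mono)
qed

text \<open>Linearity of expectation, by counting pairs of a colouring and an object whose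
  \<open>m\<close> vertices all have colour 0.\<close>

lemma sum_colourings_zero:
  assumes "finite S" "finite A" "k \<ge> 1"
    and T: "\<And>a. a \<in> A \<Longrightarrow> T a \<subseteq> S \<and> card (T a) = m"
  shows "(\<Sum>c\<in>S \<rightarrow>\<^sub>E {..<k::nat}. card {a \<in> A. \<forall>v\<in>T a. c v = 0}) * k ^ m = card A * k ^ card S"
proof -
  let ?C = "S \<rightarrow>\<^sub>E {..<k}"
  have "(\<Sum>c\<in>?C. card {a \<in> A. \<forall>v\<in>T a. c v = 0}) = (\<Sum>a\<in>A. card {c \<in> ?C. \<forall>v\<in>T a. c v = 0})"
    using assms(1,2) by (intro sum_multicount_gen) (auto simp: finite_PiE)
  moreover have "card {c \<in> ?C. \<forall>v\<in>T a. c v = 0} * k ^ m = k ^ card S" if "a \<in> A" for a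
    using card_colourings_zero[OF assms(1) _ assms(3), of "T a"] T[OF that] by simp
  ultimately show ?thesis by (simp add: sum_distrib_right)
qed

context monotone_arcs
begin

definition cross :: "'e \<Rightarrow> 'e \<Rightarrow> bool" where
  "cross e e' \<longleftrightarrow> e \<noteq> e' \<and> (\<exists>x. l e < x \<and> l e' < x \<and> x < r e \<and> x < r e' \<and> f e x = f e' x)"

definition ends :: "'e \<Rightarrow> (real \<times> real) set" where
  "ends e = {(l e, f e (l e)), (r e, f e (r e))}"

lemma card_ends: "e \<in> E \<Longrightarrow> card (ends e) = 2"
  using l_less_r[of e] by (simp add: ends_def)

lemma ends_subset: "e \<in> E \<Longrightarrow> ends e \<subseteq> S"
  by (simp add: ends_def left_in right_in)

text \<open>Deleting every arc that is the first member of a crossing pair inside \<open>V\<close>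
  leaves a noncrossing family, and at most one arc is deleted per pair.\<close>

lemma card_arcs_le_crossings:
  assumes "V \<subseteq> S"
  shows "card {e \<in> E. ends e \<subseteq> V}
    \<le> 3 * card V + card {(e, e') \<in> E \<times> E. cross e e' \<and> ends e \<union> ends e' \<subseteq> V}"
proof -
  define F where "F = {e \<in> E. ends e \<subseteq> V}"
  define X where "X = {(e, e') \<in> E \<times> E. cross e e' \<and> ends e \<union> ends e' \<subseteq> V}"
  have fin: "finite F" "finite X"
    using finite_E finite_subset[of X "E \<times> E"] by (auto simp: F_def X_def)
  have "noncrossing_arcs V (F - fst ` X) l r f"
  proof
    show "finite V" using assms finite_S finite_subset by blast
    fix e e' x
    assume "e \<in> F - fst ` X" "e' \<in> F - fst ` X" "e \<noteq> e'"
      "l e < x" "l e' < x" "x < r e" "x < r e'"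
    moreover from this have "(e, e') \<notin> X" by force
    ultimately show "f e x \<noteq> f e' x"
      by (auto simp: F_def X_def cross_def)
  next
    show "e = e'" if "e \<in> F - fst ` X" "e' \<in> F - fst ` X" "l e = l e'" "f e (l e) = f e' (l e')"
      "r e = r e'" "f e (r e) = f e' (r e')" for e e'
      using simple[OF _ _ that(3-6)] that(1,2) by (auto simp: F_def)
  qed (use fin assms in \<open>auto simp: F_def ends_def l_less_r cont dest: avoid\<close>)
  then have "card (F - fst ` X) \<le> 3 * card V"
    by (rule noncrossing_arcs.card_arcs_le)
  moreover have "card F \<le> card (F - fst ` X) + card (fst ` X)"
    using fin card_Un_le[of "F - fst ` X" "fst ` X"]
      card_mono[of "F - fst ` X \<union> fst ` X" F] by auto
  moreover have "card (fst ` X) \<le> card X"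
    using fin by (simp add: card_image_le)
  ultimately show ?thesis by (simp add: F_def X_def)
qed

text \<open>The crossing lemma: average the previous bound over a random set of vertices that contains
  each vertex with probability \<open>1 / k\<close>, and hence each crossing with probability \<open>1 / k ^ 4\<close>.\<close>

lemma card_arcs_le_few_crossings:
  assumes disj: "\<And>e e'. \<lbrakk>e \<in> E; e' \<in> E; cross e e'\<rbrakk> \<Longrightarrow> ends e \<inter> ends e' = {}"
    and few: "\<And>e. e \<in> E \<Longrightarrow> card {e' \<in> E. cross e e'} \<le> t"
    and k: "k \<ge> 1" "2 * t \<le> k\<^sup>2"
  shows "card E \<le> 6 * card S * k"
proof -
  define C where "C = S \<rightarrow>\<^sub>E {..<k}"
  define X where "X = {(e, e') \<in> E \<times> E. cross e e'}"
  \<comment> \<open>Up to the factor \<open>card C\<close>, the expected numbers of arcs, vertices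
    and crossings that survive in the random vertex set.\<close>
  define s1 where "s1 = (\<Sum>c\<in>C. card {e \<in> E. \<forall>v\<in>ends e. c v = 0})"
  define s2 where "s2 = (\<Sum>c\<in>C. card {v \<in> S. \<forall>u\<in>{v}. c u = 0})"
  define s3 where "s3 = (\<Sum>c\<in>C. card {p \<in> X. \<forall>v\<in>ends (fst p) \<union> ends (snd p). c v = 0})"
  let ?N = "k ^ card S"
  have fX: "finite X"
    using finite_E finite_subset[of X "E \<times> E"] by (auto simp: X_def)
  have s1: "s1 * k ^ 2 = card E * ?N"
    unfolding s1_def C_def
    by (rule sum_colourings_zero) (use finite_S finite_E k card_ends ends_subset in auto)
  have s2: "s2 * k ^ 1 = card S * ?N"
    unfolding s2_def C_def
    by (rule sum_colourings_zero) (use finite_S k in auto)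
  \<comment> \<open>Disjointness of the ends of crossing arcs makes each crossing depend on exactly
    four vertices, hence the exponent 4.\<close>
  have "card (ends e \<union> ends e') = 4" if "(e, e') \<in> X" for e e'
    using that disj card_ends by (subst card_Un_disjoint) (auto simp: X_def, auto simp: ends_def)
  then have s3: "s3 * k ^ 4 = card X * ?N"
    unfolding s3_def C_def
    by (intro sum_colourings_zero) (use finite_S fX k ends_subset in \<open>auto simp: X_def subset_iff\<close>)
  have "s1 \<le> 3 * s2 + s3"
    unfolding s1_def s2_def s3_def sum_distrib_left sum.distrib[symmetric]
  proof (rule sum_mono)
    fix c
    let ?V = "{v \<in> S. c v = (0::nat)}"
    have "{e \<in> E. \<forall>v\<in>ends e. c v = 0} = {e \<in> E. ends e \<subseteq> ?V}"
      using ends_subset by blast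
    moreover have "{p \<in> X. \<forall>v\<in>ends (fst p) \<union> ends (snd p). c v = 0} =
        {(e, e') \<in> E \<times> E. cross e e' \<and> ends e \<union> ends e' \<subseteq> ?V}"
      using ends_subset by (fastforce simp: X_def)
    ultimately show "card {e \<in> E. \<forall>v\<in>ends e. c v = 0} \<le> 3 * card {v \<in> S. \<forall>u\<in>{v}. c u = 0} +
        card {p \<in> X. \<forall>v\<in>ends (fst p) \<union> ends (snd p). c v = 0}"
      using card_arcs_le_crossings[of ?V] by simp
  qed
  then have "s1 * k ^ 4 \<le> (3 * s2 + s3) * k ^ 4" by (rule mult_le_mono1)
  also have "\<dots> = 3 * (s2 * k ^ 1) * k ^ 3 + s3 * k ^ 4"
    by (simp add: algebra_simps power4_eq_xxxx power3_eq_cube)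
  also have "\<dots> = (3 * card S * k ^ 3 + card X) * ?N"
    unfolding s2 s3 by (simp add: algebra_simps)
  also have "s1 * k ^ 4 = (s1 * k ^ 2) * k ^ 2"
    by (simp add: algebra_simps power4_eq_xxxx power2_eq_square)
  also have "\<dots> = card E * k ^ 2 * ?N" unfolding s1 by simp
  finally have "card E * k ^ 2 \<le> 3 * card S * k ^ 3 + card X"
    using k by simp
  moreover have "card X \<le> card E * t"
  proof -
    have "X = (SIGMA e:E. {e' \<in> E. cross e e'})" by (auto simp: X_def)
    then have "card X = (\<Sum>e\<in>E. card {e' \<in> E. cross e e'})"
      using finite_E by simp
    then show ?thesis using sum_bounded_above[of E _ t] few by simp
  qed
  \<comment> \<open>So the crossing term \<open>card E * t\<close> is at most half of
    \<open>card E * k^2\<close>; absorbing it on the left doubles the constant 3 to 6.\<close>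
  moreover have "card E * (2 * t) \<le> card E * k\<^sup>2" using k by simp
  ultimately have "card E * k ^ 2 \<le> 6 * card S * k ^ 3" by linarith
  also have "\<dots> = 6 * card S * k * k ^ 2" by (simp add: power3_eq_cube power2_eq_square)
  finally show ?thesis using k by simp
qed

end

subsection \<open>Unit semicircles\<close>


abbreviation pt :: "real \<Rightarrow> real \<Rightarrow> real^2" where
  "pt x y \<equiv> vector [x, y]"

lemma dist_eq_1_iff: "dist p (q :: real^2) = 1 \<longleftrightarrow> (p $ 1 - q $ 1)\<^sup>2 + (p $ 2 - q $ 2)\<^sup>2 = 1"
  by (simp add: dist_vec_def L2_set_def sum_2 dist_real_def)

lemma vec2_eq_iff: "p = (q :: real^2) \<longleftrightarrow> p $ 1 = q $ 1 \<and> p $ 2 = q $ 2"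
  by (simp add: vec_eq_iff forall_2)

text \<open>Centres and common points form a rhombus, whose diagonals bisect each other. The error
  vector \<open>w\<close> is orthogonal to both diagonals \<open>d\<close> and \<open>z\<close>,
  which are nonzero and orthogonal to each other, so it vanishes.\<close>

lemma unit_circles_inter:
  fixes p q x y :: "real^2"
  assumes "x \<in> sphere p 1 \<inter> sphere q 1" "y \<in> sphere p 1 \<inter> sphere q 1" "p \<noteq> q" "x \<noteq> y"
  shows "x + y = p + q"
proof -
  define w where "w = x + y - p - q"
  define d where "d = q - p"
  define z where "z = x - y"
  have eqs: "(p $ 1 - x $ 1)\<^sup>2 + (p $ 2 - x $ 2)\<^sup>2 = 1" "(q $ 1 - x $ 1)\<^sup>2 + (q $ 2 - x $ 2)\<^sup>2 = 1"
     "(p $ 1 - y $ 1)\<^sup>2 + (p $ 2 - y $ 2)\<^sup>2 = 1" "(q $ 1 - y $ 1)\<^sup>2 + (q $ 2 - y $ 2)\<^sup>2 = 1"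
    using assms(1,2) by (auto simp: dist_eq_1_iff)
  have wd: "w $ 1 * d $ 1 + w $ 2 * d $ 2 = 0" and wz: "w $ 1 * z $ 1 + w $ 2 * z $ 2 = 0"
    and zd: "z $ 1 * d $ 1 + z $ 2 * d $ 2 = 0"
    using eqs unfolding w_def d_def z_def by (simp_all, algebra+)
  \<comment> \<open>The determinant of the two diagonals; since they are orthogonal, its square is
    the product of their squared lengths.\<close>
  define D where "D = d $ 1 * z $ 2 - d $ 2 * z $ 1"
  have "D\<^sup>2 = ((d $ 1)\<^sup>2 + (d $ 2)\<^sup>2) * ((z $ 1)\<^sup>2 + (z $ 2)\<^sup>2)"
    using zd unfolding D_def by algebra
  moreover have "(d $ 1)\<^sup>2 + (d $ 2)\<^sup>2 \<noteq> 0" "(z $ 1)\<^sup>2 + (z $ 2)\<^sup>2 \<noteq> 0"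
    using assms(3,4) by (auto simp: d_def z_def vec2_eq_iff sum_power2_eq_zero_iff)
  ultimately have "D \<noteq> 0" by auto
  moreover have "w $ 1 * D = 0" "w $ 2 * D = 0"
    using wd wz unfolding D_def by algebra+
  ultimately have "w = 0" by (simp add: vec2_eq_iff)
  then show ?thesis by (simp add: w_def algebra_simps)
qed

text \<open>Once \<open>x\<close> is a common point, any other one must be
  \<open>p + q - x\<close>.\<close>

lemma card_unit_circles_inter:
  fixes p q :: "real^2"
  assumes "p \<noteq> q"
  shows "finite (sphere p 1 \<inter> sphere q 1)" "card (sphere p 1 \<inter> sphere q 1) \<le> 2"
proof -
  have "\<exists>a b. sphere p 1 \<inter> sphere q 1 \<subseteq> {a, b}"
  proof (cases "sphere p 1 \<inter> sphere q 1 = {}")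
    case False
    then obtain x where x: "x \<in> sphere p 1 \<inter> sphere q 1" by blast
    have "sphere p 1 \<inter> sphere q 1 \<subseteq> {x, p + q - x}"
      using unit_circles_inter[OF x _ assms] by (force simp: algebra_simps)
    then show ?thesis by blast
  qed simp
  then obtain a b where ab: "sphere p 1 \<inter> sphere q 1 \<subseteq> {a, b}" by blast
  then show "finite (sphere p 1 \<inter> sphere q 1)" by (rule finite_subset) simp
  show "card (sphere p 1 \<inter> sphere q 1) \<le> 2"
    using card_mono[OF _ ab] by (simp add: card_insert_if split: if_splits)
qed

text \<open>For \<open>s = 1\<close> and \<open>s = - 1\<close> the upper and the lower unit semicircle around \<open>p\<close>.\<close>

definition semicircle :: "real \<Rightarrow> real^2 \<Rightarrow> real \<Rightarrow> real" where
  "semicircle s p x = p $ 2 + s * sqrt (1 - (x - p $ 1)\<^sup>2)"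

lemma semicircle_in_sphere:
  assumes "s\<^sup>2 = 1" "\<bar>x - p $ 1\<bar> \<le> 1"
  shows "pt x (semicircle s p x) \<in> sphere p 1"
proof -
  have "(x - p $ 1)\<^sup>2 \<le> 1" using assms(2) by (simp add: abs_square_le_1)
  then show ?thesis
    using assms(1) by (simp add: dist_eq_1_iff semicircle_def power_mult_distrib) (simp add: power2_commute)
qed

lemma sphere_eq_semicircle:
  assumes "z \<in> sphere p 1" "s\<^sup>2 = 1" "0 \<le> s * (z $ 2 - p $ 2)"
  shows "\<bar>z $ 1 - p $ 1\<bar> \<le> 1" "z = pt (z $ 1) (semicircle s p (z $ 1))"
proof -
  have eq: "(z $ 1 - p $ 1)\<^sup>2 + (z $ 2 - p $ 2)\<^sup>2 = 1"
    using assms(1) by (simp add: dist_eq_1_iff power2_commute)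
  then have "(z $ 1 - p $ 1)\<^sup>2 \<le> 1" by (smt (verit) zero_le_power2)
  then show "\<bar>z $ 1 - p $ 1\<bar> \<le> 1" by (simp add: abs_square_le_1)
  have "1 - (z $ 1 - p $ 1)\<^sup>2 = (s * (z $ 2 - p $ 2))\<^sup>2"
    using eq assms(2) by (simp add: power_mult_distrib)
  then have "s * sqrt (1 - (z $ 1 - p $ 1)\<^sup>2) = s * (s * (z $ 2 - p $ 2))"
    using assms(3) by (simp only: real_sqrt_abs abs_of_nonneg)
  also have "\<dots> = s\<^sup>2 * (z $ 2 - p $ 2)" by (simp add: power2_eq_square)
  finally show "z = pt (z $ 1) (semicircle s p (z $ 1))"
    using assms(2) by (simp add: semicircle_def vec2_eq_iff)
qed

text \<open>By \<open>unit_circles_inter\<close> the two meeting heights add up to the sum of the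
  heights of the centres. The offsets from the centres all have the sign of \<open>s\<close>, so
  they vanish. Both points are then at the height of \<open>p\<close>, at its two extreme abscissae,
  which forces the centres to agree.\<close>

lemma semicircles_meet_once:
  assumes "s\<^sup>2 = 1" "p \<noteq> q" "x \<noteq> y"
    and "\<bar>x - p $ 1\<bar> \<le> 1" "\<bar>x - q $ 1\<bar> \<le> 1" "\<bar>y - p $ 1\<bar> \<le> 1" "\<bar>y - q $ 1\<bar> \<le> 1"
    and eqs: "semicircle s p x = semicircle s q x" "semicircle s p y = semicircle s q y"
  shows False
proof -
  let ?x = "pt x (semicircle s p x)" and ?y = "pt y (semicircle s p y)"
  have "?x \<in> sphere p 1 \<inter> sphere q 1" "?y \<in> sphere p 1 \<inter> sphere q 1"
    using semicircle_in_sphere assms by (metis IntI)+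
  moreover have "?x \<noteq> ?y" using assms(3) by (simp add: vec2_eq_iff)
  ultimately have "?x + ?y = p + q"
    using unit_circles_inter assms(2) by blast
  then have sum: "x + y = p $ 1 + q $ 1" "semicircle s p x + semicircle s p y = p $ 2 + q $ 2"
    by (auto simp: vec2_eq_iff)
  define h where "h c t = sqrt (1 - (t - c)\<^sup>2)" for c t :: real
  have h0: "0 \<le> h c t" if "\<bar>t - c\<bar> \<le> 1" for c t
    using that by (simp add: h_def abs_square_le_1)
  have "s * (h (p $ 1) x + h (q $ 1) y) = 0" "s * (h (p $ 1) y + h (q $ 1) x) = 0"
    using sum(2) eqs by (simp_all add: semicircle_def h_def algebra_simps)
  moreover have "s \<noteq> 0" using assms(1) by auto
  ultimately have "h (p $ 1) x = 0" "h (p $ 1) y = 0" 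
    using h0 assms(4-7) by (simp_all add: add_nonneg_eq_0_iff)
  then have "(x - p $ 1)\<^sup>2 = (y - p $ 1)\<^sup>2" by (simp add: h_def)
  then have "x + y = 2 * p $ 1" using assms(3) by (auto simp: power2_eq_iff)
  then have 1: "p $ 1 = q $ 1" using sum by simp
  then have "p $ 2 = q $ 2" using eqs by (simp add: semicircle_def)
  then show False using 1 assms(2) by (simp add: vec2_eq_iff)
qed

subsection \<open>Edges as monotone arcs\<close>

lemma edges_eqI:
  assumes "(p, A) \<in> edges P" "(p, B) \<in> edges P" "x \<in> A" "x \<in> B"
  shows "A = B"
  using assms components_nonoverlap unfolding edges_def by blast

lemma edges_subset: "(p, A) \<in> edges P \<Longrightarrow> A \<subseteq> sphere p 1 - P"
  using in_components_subset unfolding edges_def by blast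

text \<open>The open arcs of one circle are disjoint, so the centre determines the edge through
  \<open>p + v\<close>. Used with \<open>v\<close> pointing to the rightmost and leftmost
  points.\<close>

lemma card_edges_through:
  assumes "finite P"
  shows "finite {e \<in> edges P. fst e + v \<in> snd e}" "card {e \<in> edges P. fst e + v \<in> snd e} \<le> card P"
proof -
  have inj: "inj_on fst {e \<in> edges P. fst e + v \<in> snd e}"
    using edges_eqI by (fastforce intro!: inj_onI)
  have sub: "fst ` {e \<in> edges P. fst e + v \<in> snd e} \<subseteq> P"
    by (auto simp: edges_def)
  show "finite {e \<in> edges P. fst e + v \<in> snd e}"
    using inj_on_finite[OF inj sub assms] .
  show "card {e \<in> edges P. fst e + v \<in> snd e} \<le> card P"
    using card_inj_on_le[OF inj sub assms] .
qed

text \<open>A connected arc that avoids both extreme points stays on one side of the horizontal line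
  through its centre, so a single point \<open>z\<close> decides the side.\<close>

definition half_edges :: "real \<Rightarrow> (real^2) set \<Rightarrow> ((real^2) \<times> (real^2) set) set" where
  "half_edges s P = {(p, A) \<in> edges P. p + pt 1 0 \<notin> A \<and> p + pt (-1) 0 \<notin> A \<and>
     (\<exists>z\<in>A. s * (z $ 2 - p $ 2) > 0)}"

text \<open>A point of the circle at the height of the centre is an extreme point, so an edge in
  neither half passes through one.\<close>

lemma edges_cover:
  "edges P \<subseteq> {e \<in> edges P. fst e + pt 1 0 \<in> snd e} \<union> {e \<in> edges P. fst e + pt (-1) 0 \<in> snd e}
     \<union> half_edges 1 P \<union> half_edges (-1) P"
proof (rule subsetI, rule ccontr)
  fix e assume "e \<in> edges P" and n: "e \<notin> {e \<in> edges P. fst e + pt 1 0 \<in> snd e}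
      \<union> {e \<in> edges P. fst e + pt (-1) 0 \<in> snd e} \<union> half_edges 1 P \<union> half_edges (-1) P"
  moreover obtain p A where "e = (p, A)" by (cases e)
  ultimately have e: "(p, A) \<in> edges P"
    and n1: "(p, A) \<notin> half_edges (-1) P" and n2: "(p, A) \<notin> half_edges 1 P"
    and n3: "p + pt (- 1) 0 \<notin> A" and n4: "p + pt 1 0 \<notin> A"
    by auto
  obtain z where z: "z \<in> A" using e in_components_nonempty unfolding edges_def by blast
  then have "z \<in> sphere p 1" using edges_subset[OF e] by blast
  then have eq: "(z $ 1 - p $ 1)\<^sup>2 + (z $ 2 - p $ 2)\<^sup>2 = 1"
    by (simp add: dist_eq_1_iff power2_commute)
  have "z $ 2 = p $ 2"
    using n1 n2 n3 n4 z e by (force simp: half_edges_def not_less)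
  then have "z $ 1 - p $ 1 = 1 \<or> z $ 1 - p $ 1 = -1"
    using eq by (simp add: power2_eq_1_iff)
  then have "z = p + pt 1 0 \<or> z = p + pt (-1) 0"
    using \<open>z $ 2 = p $ 2\<close> by (auto simp: vec2_eq_iff)
  then show False using n3 n4 z by auto
qed

text \<open>From a point of \<open>A\<close>, follow the semicircle both ways to the nearest points
  of \<open>P\<close>. They exist because otherwise \<open>A\<close> would reach an extreme
  point.\<close>

lemma half_edge_arc:
  assumes fin: "finite P" and s: "s\<^sup>2 = 1" and e: "(p, A) \<in> half_edges s P"
  obtains l r where "l < r" "p $ 1 - 1 \<le> l" "r \<le> p $ 1 + 1"
    "pt l (semicircle s p l) \<in> P" "pt r (semicircle s p r) \<in> P"
    "\<And>x. \<lbrakk>l < x; x < r\<rbrakk> \<Longrightarrow> pt x (semicircle s p x) \<in> A"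
proof -
  define h where "h x = pt x (semicircle s p x)" for x
  obtain z where z: "z \<in> A" "s * (z $ 2 - p $ 2) > 0" and eP: "(p, A) \<in> edges P"
    and A: "A \<in> components (sphere p 1 - P)" "p + pt 1 0 \<notin> A" "p + pt (-1) 0 \<notin> A"
    using e by (auto simp: half_edges_def edges_def)
  have zS: "z \<in> sphere p 1 - P" using edges_subset[OF eP] z by blast
  define x0 where "x0 = z $ 1"
  have x0: "\<bar>x0 - p $ 1\<bar> \<le> 1" "z = h x0"
    using sphere_eq_semicircle[of z p s] zS s z(2) by (auto simp: x0_def h_def)
  have conth: "continuous_on I h" for I
  proof -
    have "continuous_on I (\<lambda>x. (\<chi> i. if i = 1 then x else semicircle s p x) :: real^2)"
      unfolding semicircle_def
    proof (rule continuous_on_vec_lambda)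
      show "continuous_on I (\<lambda>x. if i = 1 then x else p $ 2 + s * sqrt (1 - (x - p $ 1)\<^sup>2))" for i :: 2
        by (cases "i = 1") (auto intro!: continuous_intros)
    qed
    moreover have "h = (\<lambda>x. \<chi> i. if i = 1 then x else semicircle s p x)"
      by (auto simp: h_def vec2_eq_iff fun_eq_iff)
    ultimately show ?thesis by simp
  qed
  \<comment> \<open>A connected stretch of the semicircle that contains \<open>x0\<close> and avoids
    \<open>P\<close> lies in \<open>A\<close>, because components are maximal.\<close>
  have inA: "h ` I \<subseteq> A"
    if "connected I" "x0 \<in> I" "I \<subseteq> {p $ 1 - 1..p $ 1 + 1}" "\<And>x. x \<in> I \<Longrightarrow> h x \<notin> P" for I
  proof (rule components_maximal[OF A(1)])
    show "connected (h ` I)" using that conth by (intro connected_continuous_image) auto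
    show "h ` I \<subseteq> sphere p 1 - P"
      using that semicircle_in_sphere[OF s] by (fastforce simp: h_def abs_le_iff)
    show "A \<inter> h ` I \<noteq> {}" using that z x0 by blast
  qed
  define Q where "Q = {x. \<bar>x - p $ 1\<bar> \<le> 1 \<and> h x \<in> P}"
  have "inj h" by (rule injI) (simp add: h_def vec2_eq_iff)
  then have "finite (h -` P)" using fin by (simp add: finite_vimageI)
  then have finQ: "finite Q" by (rule rev_finite_subset) (auto simp: Q_def)
  have x0Q: "x0 \<notin> Q" using zS x0 by (simp add: Q_def)
  have ends: "h (p $ 1 - 1) = p + pt (-1) 0" "h (p $ 1 + 1) = p + pt 1 0"
    by (simp_all add: h_def semicircle_def vec2_eq_iff)
  define L where "L = {x \<in> Q. x < x0}"
  define R where "R = {x \<in> Q. x0 < x}"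
  have "L \<noteq> {}"
  proof
    assume "L = {}"
    then have "h ` {p $ 1 - 1..x0} \<subseteq> A"
      using x0 x0Q by (intro inA) (force simp: L_def Q_def)+
    then have "h (p $ 1 - 1) \<in> A" by (rule subsetD) (use x0 in \<open>auto simp: abs_le_iff\<close>)
    then show False using A ends by simp
  qed
  moreover have "finite L" using finQ by (simp add: L_def)
  ultimately have L: "Max L \<in> L" "\<And>x. x \<in> L \<Longrightarrow> x \<le> Max L" by simp_all
  have "R \<noteq> {}"
  proof
    assume "R = {}"
    then have "h ` {x0..p $ 1 + 1} \<subseteq> A"
      using x0 x0Q by (intro inA) (force simp: R_def Q_def)+
    then have "h (p $ 1 + 1) \<in> A" by (rule subsetD) (use x0 in \<open>auto simp: abs_le_iff\<close>)
    then show False using A ends by simp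
  qed
  moreover have "finite R" using finQ by (simp add: R_def)
  ultimately have R: "Min R \<in> R" "\<And>x. x \<in> R \<Longrightarrow> Min R \<le> x" by simp_all
  have bounds: "p $ 1 - 1 \<le> Max L" "Min R \<le> p $ 1 + 1" "Max L < x0" "x0 < Min R" 
    "h (Max L) \<in> P" "h (Min R) \<in> P"
    using L(1) R(1) by (auto simp: L_def R_def Q_def abs_le_iff)
  have "h ` {Max L<..<Min R} \<subseteq> A"
  proof (rule inA)
    fix x assume x: "x \<in> {Max L<..<Min R}"
    show "h x \<notin> P"
    proof
      assume "h x \<in> P"
      then have "x \<in> Q" using x bounds by (auto simp: Q_def abs_le_iff)
      moreover from this have "x \<noteq> x0" using x0Q by blast
      ultimately have "x \<in> L \<or> x \<in> R" by (auto simp: L_def R_def)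
      then show False using L(2)[of x] R(2)[of x] x by auto
    qed
  qed (use bounds in auto)
  then show ?thesis
    using bounds by (intro that[of "Max L" "Min R"]) (auto simp: h_def)
qed


definition coords :: "(real^2) set \<Rightarrow> (real \<times> real) set" where
  "coords P = (\<lambda>v. (v $ 1, v $ 2)) ` P"

lemma in_coords_iff: "(x, y) \<in> coords P \<longleftrightarrow> pt x y \<in> P"
proof
  assume "(x, y) \<in> coords P"
  then obtain v where "v \<in> P" "x = v $ 1" "y = v $ 2" by (auto simp: coords_def)
  moreover from this have "pt x y = v" by (simp add: vec2_eq_iff)
  ultimately show "pt x y \<in> P" by simp
qed (force simp: coords_def image_iff)

lemma card_coords: "finite P \<Longrightarrow> card (coords P) \<le> card P"
  unfolding coords_def by (rule card_image_le)

lemma half_edges_monotone_arcs: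
  assumes fin: "finite P" and s: "s\<^sup>2 = 1"
  obtains l r where "monotone_arcs (coords P) (half_edges s P) l r (\<lambda>e. semicircle s (fst e))"
    and "\<And>e. e \<in> half_edges s P \<Longrightarrow> fst e $ 1 - 1 \<le> l e \<and> r e \<le> fst e $ 1 + 1"
    and "\<And>e x. \<lbrakk>e \<in> half_edges s P; l e < x; x < r e\<rbrakk> \<Longrightarrow> pt x (semicircle s (fst e) x) \<in> snd e"
proof -
  let ?E = "half_edges s P" and ?h = "\<lambda>e. semicircle s (fst e)"
  have "\<forall>e\<in>?E. \<exists>l r. l < r \<and> fst e $ 1 - 1 \<le> l \<and> r \<le> fst e $ 1 + 1 \<and>
      pt l (?h e l) \<in> P \<and> pt r (?h e r) \<in> P \<and> (\<forall>x. l < x \<longrightarrow> x < r \<longrightarrow> pt x (?h e x) \<in> snd e)"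
  proof
    fix e assume "e \<in> ?E"
    then have "(fst e, snd e) \<in> ?E" by simp
    from half_edge_arc[OF fin s this] show "\<exists>l r. l < r \<and> fst e $ 1 - 1 \<le> l \<and> r \<le> fst e $ 1 + 1 \<and>
      pt l (?h e l) \<in> P \<and> pt r (?h e r) \<in> P \<and> (\<forall>x. l < x \<longrightarrow> x < r \<longrightarrow> pt x (?h e x) \<in> snd e)"
      by metis
  qed
  then obtain l r where lr: "\<And>e. e \<in> ?E \<Longrightarrow> l e < r e \<and> fst e $ 1 - 1 \<le> l e \<and> r e \<le> fst e $ 1 + 1 \<and>
      pt (l e) (?h e (l e)) \<in> P \<and> pt (r e) (?h e (r e)) \<in> P"
    and arc: "\<And>e x. \<lbrakk>e \<in> ?E; l e < x; x < r e\<rbrakk> \<Longrightarrow> pt x (?h e x) \<in> snd e"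
    by metis
  have edge: "(fst e, snd e) \<in> edges P" if "e \<in> ?E" for e
    using that by (auto simp: half_edges_def)
  \<comment> \<open>Two arcs of one circle with the same left end overlap just to the right of it,
    so they are the same component.\<close>
  have same_circle: "e = e'"
    if e: "e \<in> ?E" "e' \<in> ?E" and eq: "fst e = fst e'" "l e = l e'" for e e'
  proof -
    obtain x where x: "l e < x" "x < min (r e) (r e')"
      using lr[OF e(1)] lr[OF e(2)] eq dense[of "l e" "min (r e) (r e')"] by auto
    have "snd e = snd e'"
      using edges_eqI[of "fst e" "snd e" P "snd e'" "pt x (?h e x)"]
        edge[OF e(1)] edge[OF e(2)] arc[OF e(1), of x] arc[OF e(2), of x] x eq by simp
    then show ?thesis using eq by (simp add: prod_eq_iff)
  qed
  have "monotone_arcs (coords P) ?E l r ?h"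
  proof
    show "finite (coords P)" using fin by (simp add: coords_def)
    \<comment> \<open>An edge is determined by its centre and the abscissa of its left end, both
      from finite sets.\<close>
    have "inj_on (\<lambda>e. (fst e, l e)) ?E"
      by (rule inj_onI) (simp add: same_circle)
    moreover have "(\<lambda>e. (fst e, l e)) ` ?E \<subseteq> P \<times> fst ` coords P"
      using edge lr in_coords_iff by (fastforce simp: edges_def image_iff)
    ultimately show "finite ?E"
      by (rule inj_on_finite) (use fin in \<open>simp add: coords_def\<close>)
    show "continuous_on {l e..r e} (?h e)" for e
      unfolding semicircle_def by (intro continuous_intros)
    show "(x, ?h e x) \<notin> coords P" if "e \<in> ?E" "l e < x" "x < r e" for e x
      using arc[OF that] edges_subset[OF edge[OF that(1)]] by (auto simp: in_coords_iff)
    show "e = e'" if e: "e \<in> ?E" "e' \<in> ?E" and eq: "l e = l e'" "?h e (l e) = ?h e' (l e')"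
      "r e = r e'" "?h e (r e) = ?h e' (r e')" for e e'
    proof (rule same_circle[OF e _ eq(1)], rule ccontr)
      assume "fst e \<noteq> fst e'"
      then show False
        using semicircles_meet_once[OF s, of "fst e" "fst e'" "l e" "r e"] lr[OF e(1)] lr[OF e(2)] eq
        by (auto simp: abs_le_iff)
    qed
  qed (use lr in \<open>auto simp: in_coords_iff\<close>)
  then show ?thesis using lr arc by (intro that) auto
qed

section \<open>Counting edges by their number of crossings\<close>

lemma finite_edges:
  assumes "finite P"
  shows "finite (edges P)"
proof -
  have "finite (half_edges s P)" if "s\<^sup>2 = 1" for s
    by (rule half_edges_monotone_arcs[OF assms that]) (rule monotone_arcs.finite_E)
  then have "finite (half_edges 1 P)" "finite (half_edges (-1) P)" by simp_all
  then show ?thesis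
    using card_edges_through(1)[OF assms] by (intro finite_subset[OF edges_cover]) blast
qed

text \<open>Each crossing is counted from both of its edges. The two centres and the point determine
  the edges, and the centres differ because edges of one circle are disjoint; so each ordered pair
  of centres contributes at most two points.\<close>

lemma total_crossings:
  assumes "finite P"
  shows "finite (SIGMA e:edges P. crossings P e)"
    and "card (SIGMA e:edges P. crossings P e) \<le> 2 * (card P)\<^sup>2"
proof -
  let ?X = "SIGMA e:edges P. crossings P e"
  let ?Y = "SIGMA p:P. SIGMA q:P - {p}. sphere p 1 \<inter> sphere q 1"
  let ?h = "\<lambda>(e :: (real^2) \<times> (real^2) set, e' :: (real^2) \<times> (real^2) set, x :: real^2). (fst e, fst e', x)"
  have inj: "inj_on ?h ?X"
  proof (rule inj_onI)
    fix u v assume uv: "u \<in> ?X" "v \<in> ?X" "?h u = ?h v"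
    obtain p A q B x where u: "u = ((p, A), (q, B), x)" by (metis surj_pair)
    obtain p' A' q' B' x' where v: "v = ((p', A'), (q', B'), x')" by (metis surj_pair)
    show "u = v"
      using uv edges_eqI[of p A P A' x] edges_eqI[of q B P B' x] unfolding u v
      by (auto simp: crossings_def)
  qed
  have sub: "?h ` ?X \<subseteq> ?Y"
  proof (rule image_subsetI)
    fix u assume "u \<in> ?X"
    moreover obtain p A q B x where u: "u = ((p, A), (q, B), x)" by (metis surj_pair)
    ultimately have e: "(p, A) \<in> edges P"
      and e': "(q, B) \<in> edges P" "(q, B) \<noteq> (p, A)" "x \<in> A" "x \<in> B"
      by (auto simp: crossings_def)
    then have "p \<noteq> q" using edges_eqI[OF e, of B x] by auto
    moreover have "p \<in> P" "q \<in> P" using e e'(1) by (auto simp: edges_def)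
    ultimately show "?h u \<in> ?Y"
      using edges_subset[OF e] edges_subset[OF e'(1)] e'(3,4) unfolding u by auto
  qed
  have finY: "finite ?Y"
    using assms by (intro finite_SigmaI card_unit_circles_inter(1)) auto
  show "finite ?X" using inj_on_finite[OF inj sub finY] .
  have "card ?X \<le> card ?Y" using card_inj_on_le[OF inj sub finY] .
  also have "\<dots> = (\<Sum>p\<in>P. \<Sum>q\<in>P - {p}. card (sphere p 1 \<inter> sphere q 1))"
  proof -
    have "finite (SIGMA q:P - {p}. sphere p 1 \<inter> sphere q 1)" for p
      using assms by (intro finite_SigmaI card_unit_circles_inter(1)) auto
    moreover have "card (SIGMA q:P - {p}. sphere p 1 \<inter> sphere q 1) =
        (\<Sum>q\<in>P - {p}. card (sphere p 1 \<inter> sphere q 1))" for p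
      using assms by (intro card_SigmaI ballI card_unit_circles_inter(1)) auto
    ultimately show ?thesis using assms by (simp add: card_SigmaI)
  qed
  also have "\<dots> \<le> (\<Sum>p\<in>P. \<Sum>q\<in>P. 2)"
  proof (rule sum_mono)
    fix p
    have "(\<Sum>q\<in>P - {p}. card (sphere p 1 \<inter> sphere q 1)) \<le> (\<Sum>q\<in>P - {p}. 2)"
      using card_unit_circles_inter(2) by (intro sum_mono) auto
    also have "\<dots> \<le> (\<Sum>q\<in>P. 2)"
      using assms by (intro sum_mono2) auto
    finally show "(\<Sum>q\<in>P - {p}. card (sphere p 1 \<inter> sphere q 1)) \<le> (\<Sum>q\<in>P. 2)" .
  qed
  also have "\<dots> = 2 * (card P)\<^sup>2" by (simp add: power2_eq_square)
  finally show "card ?X \<le> 2 * (card P)\<^sup>2" .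
qed

text \<open>An infinite set would have \<open>card\<close> 0, so bounds through
  \<open>card (crossings P e)\<close> rely on this.\<close>

lemma finite_crossings:
  assumes "finite P" "e \<in> edges P"
  shows "finite (crossings P e)"
proof -
  have "crossings P e \<subseteq> snd ` (SIGMA e:edges P. crossings P e)" using assms(2) by force
  then show ?thesis using total_crossings(1)[OF assms(1)] finite_subset by blast
qed

lemma card_half_edges_few_crossings:
  assumes fin: "finite P" and s: "s\<^sup>2 = 1" and k: "k \<ge> 1" "2 * t \<le> k\<^sup>2"
  shows "card {e \<in> half_edges s P. card (crossings P e) \<le> t} \<le> 6 * card P * k"
proof -
  define E where "E = {e \<in> half_edges s P. card (crossings P e) \<le> t}"
  let ?h = "\<lambda>e :: (real^2) \<times> (real^2) set. semicircle s (fst e)"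
  obtain l r where M: "monotone_arcs (coords P) (half_edges s P) l r ?h"
    and lr: "\<And>e. e \<in> half_edges s P \<Longrightarrow> fst e $ 1 - 1 \<le> l e \<and> r e \<le> fst e $ 1 + 1"
    and arc: "\<And>e x. \<lbrakk>e \<in> half_edges s P; l e < x; x < r e\<rbrakk> \<Longrightarrow> pt x (?h e x) \<in> snd e"
    using half_edges_monotone_arcs[OF fin s] by blast
  interpret M: monotone_arcs "coords P" "half_edges s P" l r ?h by (rule M)
  \<comment> \<open>The crossing lemma is applied to the edges with few crossings only; their
    crossings among each other are among their crossings in the whole drawing.\<close>
  interpret E: monotone_arcs "coords P" E l r ?h
  proof
    show "e = e'" if "e \<in> E" "e' \<in> E" "l e = l e'" "?h e (l e) = ?h e' (l e')"
      "r e = r e'" "?h e (r e) = ?h e' (r e')" for e e'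
      using M.simple[OF _ _ that(3-6)] that(1,2) by (simp add: E_def)
  qed (use M.finite_S M.finite_E M.l_less_r M.cont M.left_in M.right_in M.avoid in \<open>auto simp: E_def\<close>)
  have edge: "e \<in> edges P" if "e \<in> E" for e
    using that by (auto simp: E_def half_edges_def)
  have "card E \<le> 6 * card (coords P) * k"
  proof (rule E.card_arcs_le_few_crossings[OF _ _ k])
    fix e assume e: "e \<in> E"
    have "{e' \<in> E. E.cross e e'} \<subseteq> fst ` crossings P e"
    proof clarify
      fix q B assume e': "(q, B) \<in> E" and "E.cross e (q, B)"
      then obtain x where x: "(q, B) \<noteq> e" "l e < x" "l (q, B) < x" "x < r e" "x < r (q, B)"
        "?h e x = ?h (q, B) x"
        by (auto simp: E.cross_def)
      then have "((q, B), pt x (?h e x)) \<in> crossings P e"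
        using arc[of e x] arc[of "(q, B)" x] e e' edge[OF e'] by (simp add: crossings_def E_def)
      then show "(q, B) \<in> fst ` crossings P e" by force
    qed
    then have "card {e' \<in> E. E.cross e e'} \<le> card (crossings P e)"
      using finite_crossings[OF fin edge[OF e]] surj_card_le by blast
    then show "card {e' \<in> E. E.cross e e'} \<le> t" using e by (simp add: E_def)
  next
    fix e e' assume e: "e \<in> E" "e' \<in> E" and "E.cross e e'"
    then obtain x where x: "e \<noteq> e'" "l e < x" "l e' < x" "x < r e" "x < r e'" "?h e x = ?h e' x"
      by (auto simp: E.cross_def)
    have hE: "e \<in> half_edges s P" "e' \<in> half_edges s P" using e by (auto simp: E_def)
    have fst: "fst e \<noteq> fst e'"
    proof
      assume eq: "fst e = fst e'"
      have "snd e = snd e'"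
      proof (rule edges_eqI)
        show "(fst e, snd e) \<in> edges P" using edge[OF e(1)] by simp
        show "(fst e, snd e') \<in> edges P" using edge[OF e(2)] by (simp add: eq)
        show "pt x (?h e x) \<in> snd e" using arc[OF hE(1) x(2,4)] .
        show "pt x (?h e x) \<in> snd e'" using arc[OF hE(2) x(3,5)] x(6) by simp
      qed
      then show False using x(1) eq by (simp add: prod_eq_iff)
    qed
    show "E.ends e \<inter> E.ends e' = {}"
    \<comment> \<open>A common end at abscissa \<open>a\<close> would be a second meeting of the two
      semicircles, different from the crossing at \<open>x\<close>, which is interior to both
      arcs.\<close>
    proof (rule ccontr)
      assume "E.ends e \<inter> E.ends e' \<noteq> {}"
      then obtain v where "v \<in> E.ends e" "v \<in> E.ends e'" by blast
      then obtain a where "a = l e \<or> a = r e" "a = l e' \<or> a = r e'" "?h e a = ?h e' a"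
        unfolding E.ends_def by (intro that[of "fst v"]) auto
      then show False
        using semicircles_meet_once[OF s fst, of a x] x lr[OF hE(1)] lr[OF hE(2)]
          E.l_less_r[OF e(1)] E.l_less_r[OF e(2)]
        by (auto simp: abs_le_iff)
    qed
  qed
  also have "\<dots> \<le> 6 * card P * k"
    using card_coords[OF fin] by simp
  finally show ?thesis by (simp add: E_def)
qed

lemma card_edges_few_crossings:
  assumes fin: "finite P" and k: "k \<ge> 1" "2 * t \<le> k\<^sup>2"
  shows "card {e \<in> edges P. card (crossings P e) \<le> t} \<le> 2 * card P + 12 * card P * k"
proof -
  let ?D = "\<lambda>v. {e \<in> edges P. fst e + v \<in> snd e}"
  let ?H = "\<lambda>s. {e \<in> half_edges s P. card (crossings P e) \<le> t}"
  have "finite (half_edges s P)" for s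
    using finite_edges[OF fin] by (rule rev_finite_subset) (auto simp: half_edges_def)
  then have "card {e \<in> edges P. card (crossings P e) \<le> t}
      \<le> card (?D (pt 1 0) \<union> ?D (pt (-1) 0) \<union> ?H 1 \<union> ?H (-1))"
    using edges_cover card_edges_through(1)[OF fin] by (intro card_mono) auto
  also have "\<dots> \<le> card (?D (pt 1 0)) + card (?D (pt (-1) 0)) + card (?H 1) + card (?H (-1))"
    by (intro order.trans[OF card_Un_le] add_mono order.refl)
  also have "\<dots> \<le> card P + card P + 6 * card P * k + 6 * card P * k"
    by (intro add_mono card_edges_through(2) card_half_edges_few_crossings fin k) auto
  finally show ?thesis by (simp add: algebra_simps)
qed

lemma card_edges_few_crossings_real:
  assumes "finite P" "t \<ge> 0"
  shows "real (card {e \<in> edges P. real (card (crossings P e)) \<le> t})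
    \<le> 26 * real (card P) + 12 * real (card P) * sqrt (2 * t)"
proof -
  \<comment> \<open>The added 1 ensures that \<open>k\<close> is at least 1 even for
    \<open>t = 0\<close>; the resulting excess of at most 2 over the root turns the term 2 into 2 +
    24 = 26.\<close>
  define k where "k = nat \<lceil>sqrt (2 * t)\<rceil> + 1"
  have k: "sqrt (2 * t) \<le> real k" "real k \<le> sqrt (2 * t) + 2"
  proof -
    have "0 \<le> sqrt (2 * t)" using assms(2) by simp
    then show "sqrt (2 * t) \<le> real k" "real k \<le> sqrt (2 * t) + 2"
      unfolding k_def by linarith+
  qed
  have "2 * real (nat \<lfloor>t\<rfloor>) \<le> 2 * t" using assms(2) by simp
  also have "\<dots> = (sqrt (2 * t))\<^sup>2" using assms(2) by simp
  also have "\<dots> \<le> (real k)\<^sup>2" using k(1) assms(2) by (intro power_mono) auto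
  finally have "real (2 * nat \<lfloor>t\<rfloor>) \<le> real (k\<^sup>2)" by simp
  then have "2 * nat \<lfloor>t\<rfloor> \<le> k\<^sup>2" by (simp only: of_nat_le_iff)
  then have "card {e \<in> edges P. card (crossings P e) \<le> nat \<lfloor>t\<rfloor>} \<le> 2 * card P + 12 * card P * k"
    by (intro card_edges_few_crossings assms) (simp add: k_def)
  moreover have "{e \<in> edges P. card (crossings P e) \<le> nat \<lfloor>t\<rfloor>} =
      {e \<in> edges P. real (card (crossings P e)) \<le> t}"
    using assms(2) by (auto simp: le_nat_iff le_floor_iff)
  ultimately have "real (card {e \<in> edges P. real (card (crossings P e)) \<le> t})
      \<le> real (2 * card P + 12 * card P * k)"
    by (simp only: of_nat_le_iff)
  also have "\<dots> = 2 * real (card P) + 12 * real (card P) * real k" by simp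
  also have "\<dots> \<le> 2 * real (card P) + 12 * real (card P) * (sqrt (2 * t) + 2)"
    by (intro add_left_mono mult_left_mono k(2)) simp
  finally show ?thesis by (simp add: algebra_simps)
qed

text \<open>Markov's inequality: each of these edges accounts for at least \<open>t\<close> of the
  at most \<open>2 * (card P)^2\<close> pairs of an edge and a crossing on it.\<close>

lemma card_edges_many_crossings:
  assumes "finite P"
  shows "real (card {e \<in> edges P. real (card (crossings P e)) \<ge> t}) * t \<le> 2 * (real (card P))\<^sup>2"
proof -
  let ?B = "{e \<in> edges P. real (card (crossings P e)) \<ge> t}"
  have "real (card ?B) * t \<le> (\<Sum>e\<in>?B. real (card (crossings P e)))"
    using sum_bounded_below[of ?B t] by simp
  also have "\<dots> \<le> (\<Sum>e\<in>edges P. real (card (crossings P e)))"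
    using finite_edges[OF assms] by (intro sum_mono2) auto
  also have "\<dots> = real (card (SIGMA e:edges P. crossings P e))"
    using finite_edges[OF assms] finite_crossings[OF assms] by simp
  also have "\<dots> \<le> real (2 * (card P)\<^sup>2)"
    using total_crossings(2)[OF assms] by (simp only: of_nat_le_iff)
  finally show ?thesis by simp
qed

subsection \<open>Asymptotics\<close>

lemma eventually_at_top_in:
  "eventually Q (at_top_in N) \<longleftrightarrow> eventually (\<lambda>n. n \<in> N \<longrightarrow> Q n) at_top"
  by (simp add: at_top_in_def eventually_inf_principal)

lemma eventually_in_at_top_in: "eventually (\<lambda>n. n \<in> N) (at_top_in N)"
  by (simp add: eventually_at_top_in)

theorem proposition1p3:
  fixes c\<^sub>1 :: real and N :: "nat set" and P :: "nat \<Rightarrow> (real^2) set"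
  assumes "c\<^sub>1 > 0"
    and "infinite N"
    and "\<forall>n\<in>N. n > 0"
    and "\<forall>n\<in>N. finite (P n) \<and> card (P n) = n"
    and "\<forall>n\<in>N. real (card (unit_distances (P n))) \<ge> c\<^sub>1 * real n powr (4/3)"
  shows "(\<forall>f :: nat \<Rightarrow> real.
            (\<forall>n\<in>N. f n \<ge> 0) \<longrightarrow>
            f \<in> o[at_top_in N](\<lambda>n. real n powr (2/3)) \<longrightarrow>
            (\<lambda>n. real (card {e \<in> edges (P n). real (card (crossings (P n) e)) \<le> f n}))
              \<in> o[at_top_in N](\<lambda>n. real n powr (4/3))) \<and>
         (\<forall>g :: nat \<Rightarrow> real.
            (\<forall>n\<in>N. g n \<ge> 0) \<longrightarrow>
            g \<in> \<omega>[at_top_in N](\<lambda>n. real n powr (2/3)) \<longrightarrow>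
            (\<lambda>n. real (card {e \<in> edges (P n). real (card (crossings (P n) e)) \<ge> g n}))
              \<in> o[at_top_in N](\<lambda>n. real n powr (4/3)))"
proof (intro conjI allI impI)
  fix f :: "nat \<Rightarrow> real"
  assume f0: "\<forall>n\<in>N. f n \<ge> 0" and f: "f \<in> o[at_top_in N](\<lambda>n. real n powr (2/3))"
  show "(\<lambda>n. real (card {e \<in> edges (P n). real (card (crossings (P n) e)) \<le> f n}))
      \<in> o[at_top_in N](\<lambda>n. real n powr (4/3))"
  proof (rule landau_o.smallI)
    fix c :: real assume c: "c > 0"
    have "(\<lambda>n. real n powr 1) \<in> o(\<lambda>n. real n powr (4/3))"
      by (subst powr_smallo_iff) (auto simp: filterlim_real_sequentially)
    \<comment> \<open>The factor \<open>c / 52\<close> makes the linear term \<open>26 * n\<close>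
      at most half of the target.\<close>
    then have "eventually (\<lambda>n. norm (real n powr 1) \<le> c / 52 * norm (real n powr (4/3))) at_top"
      using c by (intro landau_o.smallD) auto
    then have "eventually (\<lambda>n. real n \<le> c / 52 * real n powr (4/3)) (at_top_in N)"
      unfolding eventually_at_top_in by eventually_elim simp
    \<comment> \<open>The factor is chosen so that \<open>sqrt (2 * f n)\<close> is at most
      \<open>c / 24 * n powr (1/3)\<close>, which makes the term with factor 12 the other
      half.\<close>
    moreover have "eventually (\<lambda>n. norm (f n) \<le> (c / 24)\<^sup>2 / 2 * norm (real n powr (2/3))) (at_top_in N)"
      using f c by (intro landau_o.smallD) auto
    ultimately show "eventually (\<lambda>n. norm (real (card {e \<in> edges (P n). real (card (crossings (P n) e)) \<le> f n}))
        \<le> c * norm (real n powr (4/3))) (at_top_in N)"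
      using eventually_in_at_top_in[of N]
    proof eventually_elim
      case (elim n)
      then have n: "n > 0" "finite (P n)" "card (P n) = n" "f n \<ge> 0" using assms f0 by auto
      have "(real n powr (1/3))\<^sup>2 = real n powr (2/3)"
        by (simp add: power2_eq_square flip: powr_add)
      then have "(c / 24)\<^sup>2 * real n powr (2/3) = (c / 24 * real n powr (1/3))\<^sup>2"
        by (simp only: power_mult_distrib)
      then have "sqrt (2 * f n) \<le> sqrt ((c / 24 * real n powr (1/3))\<^sup>2)"
        using elim(2) n by (intro real_sqrt_le_mono) simp
      also have "\<dots> = c / 24 * real n powr (1/3)" using c by simp
      finally have sq: "sqrt (2 * f n) \<le> c / 24 * real n powr (1/3)" .
      have "real (card {e \<in> edges (P n). real (card (crossings (P n) e)) \<le> f n})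
          \<le> 26 * real n + 12 * real n * sqrt (2 * f n)"
        using card_edges_few_crossings_real[OF n(2,4)] n(3) by simp
      also have "\<dots> \<le> 26 * (c / 52 * real n powr (4/3)) + 12 * real n * (c / 24 * real n powr (1/3))"
        using elim(1) sq by (intro add_mono mult_left_mono) auto
      also have "12 * real n * (c / 24 * real n powr (1/3)) = c / 2 * (real n powr 1 * real n powr (1/3))"
        by simp
      also have "real n powr 1 * real n powr (1/3) = real n powr (4/3)"
        by (subst powr_add[symmetric]) simp
      finally show ?case by simp
    qed
  qed
next
  fix g :: "nat \<Rightarrow> real"
  assume g: "g \<in> \<omega>[at_top_in N](\<lambda>n. real n powr (2/3))" and g0: "\<forall>n\<in>N. g n \<ge> 0"
  show "(\<lambda>n. real (card {e \<in> edges (P n). real (card (crossings (P n) e)) \<ge> g n}))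
      \<in> o[at_top_in N](\<lambda>n. real n powr (4/3))"
  proof (rule landau_o.smallI)
    fix c :: real assume c: "c > 0"
    \<comment> \<open>With the factor \<open>2 / c\<close>, dividing the total
      \<open>2 * n^2\<close> by the lower bound on \<open>g n\<close> gives exactly
      \<open>c * n powr (4/3)\<close>.\<close>
    have "eventually (\<lambda>n. norm (g n) \<ge> 2 / c * norm (real n powr (2/3))) (at_top_in N)"
      using g c by (intro landau_omega.smallD) auto
    then show "eventually (\<lambda>n. norm (real (card {e \<in> edges (P n). real (card (crossings (P n) e)) \<ge> g n}))
        \<le> c * norm (real n powr (4/3))) (at_top_in N)"
      using eventually_in_at_top_in[of N]
    proof eventually_elim
      case (elim n)
      then have n: "n > 0" "finite (P n)" "card (P n) = n" and gn: "g n \<ge> 2 / c * real n powr (2/3)"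
        using assms g0 by auto
      let ?m = "real (card {e \<in> edges (P n). real (card (crossings (P n) e)) \<ge> g n})"
      have "?m * (2 / c * real n powr (2/3)) \<le> ?m * g n"
        by (intro mult_left_mono gn) simp
      also have "\<dots> \<le> 2 * (real n)\<^sup>2"
        using card_edges_many_crossings[OF n(2)] n(3) by simp
      also have "(real n)\<^sup>2 = real n powr (4/3) * real n powr (2/3)"
        using n(1) by (simp flip: powr_add powr_numeral)
      finally have "?m * real n powr (2/3) \<le> (c * real n powr (4/3)) * real n powr (2/3)"
        using c by (simp add: field_simps)
      then show ?case using n(1) by simp
    qed
  qed
qed

end
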